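(* For any $n>0$, distinct atoms $a_1,\dots,a_n$, $k\ge0$ and $1\le l\le n$, the derivation $\Gamma^n_{k,l}(a_1,\dots,a_n)$ (with its general weakening and coweakening instances realised by atomic ones) is a derivation using only the rules $\mathsf{aw}{\downarrow}$ and $\mathsf{aw}{\uparrow}$ (and $=$) from $\theta^n_k(a_1,\dots,a_n)\{a_l/\mathsf f\}$ to $\theta^n_{k+1}(a_1,\dots,a_n)\{a_l/\mathsf t\}$, and its size is $n^{O(\log n)}$.
   Context: Formulae are built from units $\mathsf t,\mathsf f$ and atoms by $[\alpha\vee\beta]$ and $(\alpha\wedge\beta)$. A context $\xi\{\ \}$ is a formula with a hole; a rule with premiss $\alpha$ and conclusion $\beta$ yields steps $\xi\{\gamma\}\to\xi\{\delta\}$ for instances $\gamma,\delta$ of $\alpha,\beta$. A derivation is a chain of steps; size = number of unit and atom occurrences. Rules: $\mathsf{aw}{\downarrow}$: $\mathsf f\to a$; $\mathsf{aw}{\uparrow}$: $a\to\mathsf t$ ($a$ an atom); general weakening $\mathsf w{\downarrow}$: $\mathsf f\to\alpha$ and general coweakening $\mathsf w{\uparrow}$: $\alpha\to\mathsf t$ ($\alpha$ any formula), which can be realised by derivations of atomic weakenings/coweakenings; the rule $=$ replaces a formula by one equal modulo associativity/commutativity of $\vee,\wedge$ and $[\alpha\vee\mathsf f]=\alpha$, $(\alpha\wedge\mathsf t)=\alpha$, $[\mathsf t\vee\mathsf t]=\mathsf t$, $(\mathsf f\wedge\mathsf f)=\mathsf f$ under contexts. A formula used as a derivation denotes the trivial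 derivation. For derivations $\Phi$ from $\alpha$ to $\beta$ and $\Psi$ from $\gamma$ to $\delta$, $[\Phi\vee\Psi]$ (resp. $(\Phi\wedge\Psi)$) denotes the derivation from $[\alpha\vee\gamma]$ to $[\beta\vee\delta]$ (resp. $(\alpha\wedge\gamma)$ to $(\beta\wedge\delta)$) performing $\Phi$ and $\Psi$ inside the respective contexts; $n$-ary versions similarly. $\alpha\{a/\beta\}$ substitutes $\beta$ for all occurrences of atom $a$ (not $\bar a$). Threshold formulae: for $n>0$, distinct (pairwise neither equal nor dual) atoms $a_1,\dots,a_n$, $p=\lfloor n/2\rfloor$, $q=n-p$: $\theta^n_0\equiv\mathsf t$; $\theta^n_k\equiv\mathsf f$ for $k>n$; $\theta^1_1(a_1)\equiv a_1$; for $n>1$, $0<k\le n$: $\theta^n_k(a_1,\dots,a_n)\equiv\bigvee_{i+j=k,0\le i\le p,0\le j\le q}(\theta^p_i(a_1,\dots,a_p)\wedge\theta^q_j(a_{p+1},\dots,a_n))$. Note $\theta^p_p(a_1,\dots,a_p)=(a_1\wedge\dots\wedge a_p)$. For $n>1$, $1\le l\le n$: $\Upsilon^n_{k,l}$ is: if $p\le k\le n$ and $l\le p$, the derivation from $(\theta^p_p(a_1,\dots,a_p)\{a_l/\mathsf f\}\wedge\theta^q_{k-p}(a_{p+1},\dots,a_n))=((a_1\wedge\dots\wedge a_{l-1}\wedge a_{l+1}\wedge\dots\wedge a_p\wedge\theta^q_{k-p}(a_{p+1},\dots,a_n))\wedge\mathsf f)$ to $(\mathsf t\wedge\mathsf f)=\mathsf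 f$ applying $\mathsf w{\uparrow}$ to the first conjunct; if $q\le k\le n$ and $p<l$, the analogous derivation from $(\theta^p_{k-q}(a_1,\dots,a_p)\wedge\theta^q_q(a_{p+1},\dots,a_n)\{a_l/\mathsf f\})$ to $\mathsf f$; otherwise the trivial derivation $\mathsf f$. $\Delta^n_{k,l}$ is: $\mathsf w{\downarrow}$ from $\mathsf f$ to $\theta^q_k(a_{p+1},\dots,a_n)$ if $0<k\le q$ and $l\le p$; $\mathsf w{\downarrow}$ from $\mathsf f$ to $\theta^p_k(a_1,\dots,a_p)$ if $0<k\le p$ and $p<l$; otherwise $\mathsf f$. $\Gamma^n_{k,l}(a_1,\dots,a_n)$ is defined recursively: $\Gamma^1_{0,1}(a_1)=\mathsf t$; $\Gamma^1_{k,1}(a_1)=\mathsf f$ for $k>0$; $\Gamma^n_{k,l}=\mathsf f$ for $k>n$; for $n>1$ and $k\le n$: if $l\le p$, $\Gamma^n_{k,l}=[\bigvee_{i+j=k,0\le i<p,0\le j\le q}(\Gamma^p_{i,l}(a_1,\dots,a_p)\wedge\theta^q_j(a_{p+1},\dots,a_n))\vee\Upsilon^n_{k,l}\vee\Delta^n_{k+1,l}]$; if $p<l$, $\Gamma^n_{k,l}=[\bigvee_{i+j=k,0\le i\le p,0\le j<q}(\theta^p_i(a_1,\dots,a_p)\wedge\Gamma^q_{j,l-p}(a_{p+1},\dots,a_n))\vee\Upsilon^n_{k,l}\vee\Delta^n_{k+1,l}]$. *)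

theory Defs
  imports "HOL-Library.Landau_Symbols"
begin

datatype 'v atom = Pos 'v | Neg 'v

fun dual :: "'v atom \<Rightarrow> 'v atom" where
  "dual (Pos v) = Neg v"
| "dual (Neg v) = Pos v"

definition distinct_atoms :: "'v atom list \<Rightarrow> bool" where
  "distinct_atoms as \<longleftrightarrow>
     (\<forall>i < length as. \<forall>j < length as. i \<noteq> j \<longrightarrow> as ! i \<noteq> as ! j \<and> as ! i \<noteq> dual (as ! j))"

datatype 'v formula =
    Tt
  | Ff
  | Atom "'v atom"
  | Disj "'v formula" "'v formula"
  | Conj "'v formula" "'v formula"

fun formula_size :: "'v formula \<Rightarrow> nat" where
  "formula_size Tt = 1"
| "formula_size Ff = 1"
| "formula_size (Atom a) = 1"
| "formula_size (Disj \<alpha> \<beta>) = formula_size \<alpha> + formula_size \<beta>"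
| "formula_size (Conj \<alpha> \<beta>) = formula_size \<alpha> + formula_size \<beta>"

text \<open>\<open>subst a \<beta> \<alpha>\<close> is $\alpha\{a/\beta\}$; occurrences of the dual of \<open>a\<close> are left alone.\<close>

fun subst :: "'v atom \<Rightarrow> 'v formula \<Rightarrow> 'v formula \<Rightarrow> 'v formula" where
  "subst a \<beta> Tt = Tt"
| "subst a \<beta> Ff = Ff"
| "subst a \<beta> (Atom b) = (if b = a then \<beta> else Atom b)"
| "subst a \<beta> (Disj \<gamma> \<delta>) = Disj (subst a \<beta> \<gamma>) (subst a \<beta> \<delta>)"
| "subst a \<beta> (Conj \<gamma> \<delta>) = Conj (subst a \<beta> \<gamma>) (subst a \<beta> \<delta>)"

fun big_disj :: "'v formula list \<Rightarrow> 'v formula" where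
  "big_disj [] = Ff"
| "big_disj [\<alpha>] = \<alpha>"
| "big_disj (\<alpha> # \<beta> # \<gamma>s) = Disj \<alpha> (big_disj (\<beta> # \<gamma>s))"

fun big_conj :: "'v formula list \<Rightarrow> 'v formula" where
  "big_conj [] = Tt"
| "big_conj [\<alpha>] = \<alpha>"
| "big_conj (\<alpha> # \<beta> # \<gamma>s) = Conj \<alpha> (big_conj (\<beta> # \<gamma>s))"

datatype 'v ctxt =
    Hole
  | DisjL "'v ctxt" "'v formula"
  | DisjR "'v formula" "'v ctxt"
  | ConjL "'v ctxt" "'v formula"
  | ConjR "'v formula" "'v ctxt"

fun plug :: "'v ctxt \<Rightarrow> 'v formula \<Rightarrow> 'v formula" where
  "plug Hole \<gamma> = \<gamma>"
| "plug (DisjL \<xi> \<beta>) \<gamma> = Disj (plug \<xi> \<gamma>) \<beta>"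
| "plug (DisjR \<alpha> \<xi>) \<gamma> = Disj \<alpha> (plug \<xi> \<gamma>)"
| "plug (ConjL \<xi> \<beta>) \<gamma> = Conj (plug \<xi> \<gamma>) \<beta>"
| "plug (ConjR \<alpha> \<xi>) \<gamma> = Conj \<alpha> (plug \<xi> \<gamma>)"

text \<open>A rule is given by the set of its instances, as a relation from premiss to conclusion.\<close>

type_synonym 'v inf_rule = "'v formula \<Rightarrow> 'v formula \<Rightarrow> bool"

inductive eq_rule :: "'v inf_rule" where
  disj_comm: "eq_rule (Disj \<alpha> \<beta>) (Disj \<beta> \<alpha>)"
| conj_comm: "eq_rule (Conj \<alpha> \<beta>) (Conj \<beta> \<alpha>)"
| disj_assoc: "eq_rule (Disj (Disj \<alpha> \<beta>) \<gamma>) (Disj \<alpha> (Disj \<beta> \<gamma>))"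
| conj_assoc: "eq_rule (Conj (Conj \<alpha> \<beta>) \<gamma>) (Conj \<alpha> (Conj \<beta> \<gamma>))"
| disj_Ff: "eq_rule (Disj \<alpha> Ff) \<alpha>"
| conj_Tt: "eq_rule (Conj \<alpha> Tt) \<alpha>"
| Tt_Tt: "eq_rule (Disj Tt Tt) Tt"
| Ff_Ff: "eq_rule (Conj Ff Ff) Ff"
| in_context: "eq_rule \<alpha> \<beta> \<Longrightarrow> eq_rule (plug \<xi> \<alpha>) (plug \<xi> \<beta>)"
| refl: "eq_rule \<alpha> \<alpha>"
| sym: "eq_rule \<alpha> \<beta> \<Longrightarrow> eq_rule \<beta> \<alpha>"
| trans: "eq_rule \<alpha> \<beta> \<Longrightarrow> eq_rule \<beta> \<gamma> \<Longrightarrow> eq_rule \<alpha> \<gamma>"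

inductive aw_down :: "'v inf_rule" where
  "aw_down Ff (Atom a)"

inductive aw_up :: "'v inf_rule" where
  "aw_up (Atom a) Tt"

inductive inf_step :: "'v inf_rule set \<Rightarrow> 'v formula \<Rightarrow> 'v formula \<Rightarrow> bool" for R where
  "r \<in> R \<Longrightarrow> r \<gamma> \<delta> \<Longrightarrow> inf_step R (plug \<xi> \<gamma>) (plug \<xi> \<delta>)"

text \<open>A derivation is the nonempty list of the formulae in a chain of inference steps, from
  premiss to conclusion. A singleton list is a trivial derivation.\<close>

type_synonym 'v deriv = "'v formula list"

definition derivation :: "'v inf_rule set \<Rightarrow> 'v deriv \<Rightarrow> 'v formula \<Rightarrow> 'v formula \<Rightarrow> bool" where
  "derivation R \<Phi> \<alpha> \<beta> \<longleftrightarrow>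
     \<Phi> \<noteq> [] \<and> hd \<Phi> = \<alpha> \<and> last \<Phi> = \<beta> \<and> successively (inf_step R) \<Phi>"

definition deriv_size :: "'v deriv \<Rightarrow> nat" where
  "deriv_size \<Phi> = sum_list (map formula_size \<Phi>)"

text \<open>Parallel composition performs the steps of the left derivation first.\<close>

definition disj_deriv :: "'v deriv \<Rightarrow> 'v deriv \<Rightarrow> 'v deriv" where
  "disj_deriv \<Phi> \<Psi> = map (\<lambda>\<gamma>. Disj \<gamma> (hd \<Psi>)) \<Phi> @ map (Disj (last \<Phi>)) (tl \<Psi>)"

definition conj_deriv :: "'v deriv \<Rightarrow> 'v deriv \<Rightarrow> 'v deriv" where
  "conj_deriv \<Phi> \<Psi> = map (\<lambda>\<gamma>. Conj \<gamma> (hd \<Psi>)) \<Phi> @ map (Conj (last \<Phi>)) (tl \<Psi>)"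

fun big_disj_deriv :: "'v deriv list \<Rightarrow> 'v deriv" where
  "big_disj_deriv [] = [Ff]"
| "big_disj_deriv [\<Phi>] = \<Phi>"
| "big_disj_deriv (\<Phi> # \<Psi> # \<Theta>s) = disj_deriv \<Phi> (big_disj_deriv (\<Psi> # \<Theta>s))"

text \<open>\<open>weaken b \<alpha>\<close> realises general weakening from \<open>Ff\<close> to \<open>\<alpha>\<close>, and \<open>coweaken b \<alpha>\<close> general
  coweakening from \<open>\<alpha>\<close> to \<open>Tt\<close>, by atomic steps. The step from \<open>Ff\<close> to \<open>Tt\<close>, which is not an
  instance of an atomic rule, passes through the auxiliary atom \<open>b\<close>.\<close>

fun weaken :: "'v atom \<Rightarrow> 'v formula \<Rightarrow> 'v deriv" where
  "weaken b Tt = [Ff, Atom b, Tt]"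
| "weaken b Ff = [Ff]"
| "weaken b (Atom a) = [Ff, Atom a]"
| "weaken b (Disj \<alpha> \<beta>) = Ff # disj_deriv (weaken b \<alpha>) (weaken b \<beta>)"
| "weaken b (Conj \<alpha> \<beta>) = Ff # conj_deriv (weaken b \<alpha>) (weaken b \<beta>)"

fun coweaken :: "'v atom \<Rightarrow> 'v formula \<Rightarrow> 'v deriv" where
  "coweaken b Tt = [Tt]"
| "coweaken b Ff = [Ff, Atom b, Tt]"
| "coweaken b (Atom a) = [Atom a, Tt]"
| "coweaken b (Disj \<alpha> \<beta>) = disj_deriv (coweaken b \<alpha>) (coweaken b \<beta>) @ [Tt]"
| "coweaken b (Conj \<alpha> \<beta>) = conj_deriv (coweaken b \<alpha>) (coweaken b \<beta>) @ [Tt]"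

definition splits :: "nat \<Rightarrow> nat \<Rightarrow> nat \<Rightarrow> (nat \<times> nat) list" where
  "splits k r s = [(i, j). i \<leftarrow> [0..<r], j \<leftarrow> [0..<s], i + j = k]"

text \<open>\<open>theta k as\<close> is $\theta^n_k(a_1,\dots,a_n)$, where \<open>n\<close> is the length of \<open>as\<close>. The bounds of
  \<^const>\<open>splits\<close> are strict.\<close>

function theta :: "nat \<Rightarrow> 'v atom list \<Rightarrow> 'v formula" where
  "theta k as =
     (let n = length as; p = n div 2; q = n - p in
      if k = 0 then Tt
      else if k > n then Ff
      else if n = 1 then Atom (as ! 0)
      else big_disj (map (\<lambda>(i, j). Conj (theta i (take p as)) (theta j (drop p as)))
             (splits k (p + 1) (q + 1))))"
  by pat_completeness auto
termination
  by (relation "measure (\<lambda>(k, as). length as)") auto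

declare theta.simps [simp del]

text \<open>In \<open>Upsilon\<close>, \<open>Delta\<close> and \<open>Gamma\<close> the index \<open>l\<close> counts from 1, so $a_l$ is \<open>as ! (l - 1)\<close>
  and \<open>take (l - 1) as @ drop l as\<close> omits it.\<close>

definition Upsilon :: "nat \<Rightarrow> nat \<Rightarrow> 'v atom list \<Rightarrow> 'v deriv" where
  "Upsilon k l as =
     (let n = length as; p = n div 2; q = n - p; ps = take p as; qs = drop p as; a = as ! (l - 1) in
      if p \<le> k \<and> k \<le> n \<and> l \<le> p then
        [Conj (subst a Ff (theta p ps)) (theta (k - p) qs)]
        @ conj_deriv
            (coweaken (hd qs)
              (big_conj (map Atom (take (l - 1) ps @ drop l ps) @ [theta (k - p) qs])))
            [Ff]
        @ [Ff]
      else if q \<le> k \<and> k \<le> n \<and> p < l then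
        [Conj (theta (k - q) ps) (subst a Ff (theta q qs))]
        @ conj_deriv
            (coweaken (hd ps)
              (big_conj (theta (k - q) ps # map Atom (take (l - p - 1) qs @ drop (l - p) qs))))
            [Ff]
        @ [Ff]
      else [Ff])"

definition Delta :: "nat \<Rightarrow> nat \<Rightarrow> 'v atom list \<Rightarrow> 'v deriv" where
  "Delta k l as =
     (let n = length as; p = n div 2; q = n - p; ps = take p as; qs = drop p as in
      if 0 < k \<and> k \<le> q \<and> l \<le> p then weaken (hd qs) (theta k qs)
      else if 0 < k \<and> k \<le> p \<and> p < l then weaken (hd ps) (theta k ps)
      else [Ff])"

function Gamma :: "nat \<Rightarrow> nat \<Rightarrow> 'v atom list \<Rightarrow> 'v deriv" where
  "Gamma k l as =
     (let n = length as; p = n div 2; q = n - p in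
      if k > n then [Ff]
      else if n \<le> 1 then (if k = 0 then [Tt] else [Ff])
      else if l \<le> p then
        big_disj_deriv
          (map (\<lambda>(i, j). conj_deriv (Gamma i l (take p as)) [theta j (drop p as)])
             (splits k p (q + 1))
           @ [Upsilon k l as, Delta (k + 1) l as])
      else
        big_disj_deriv
          (map (\<lambda>(i, j). conj_deriv [theta i (take p as)] (Gamma j (l - p) (drop p as)))
             (splits k (p + 1) q)
           @ [Upsilon k l as, Delta (k + 1) l as]))"
  by pat_completeness auto
termination
  by (relation "measure (\<lambda>(k, l, as). length as)") auto

declare Gamma.simps [simp del]

end

theory Submission
  imports Defs "HOL-Library.Multiset"
begin

text \<open>Modulo the rule \<open>=\<close>, disjunction with \<open>Ff\<close> and conjunction with \<open>Tt\<close> are commutative monoids,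
  so each end of $\Gamma^n_{k,l}$ is compared with the threshold formula by matching the pairs $(i,j)$
  of the two big disjunctions. Let $l \le p$. In the premiss, the pairs with $i < p$ come from the
  recursive derivations, and the one pair with $i = p$ is the premiss of $\Upsilon^n_{k,l}$. In the
  conclusion, the recursive derivations have moved $(i,j)$ to $(i+1,j)$, and the pair $(0,k+1)$
  that this leaves out is supplied by $\Delta^n_{k+1,l}$. The case $p < l$ is symmetric.

  For the size, let $n \le 2^d$. Doubling $n$ multiplies the bound on each of the size of a threshold
  formula, the number of lines of $\Gamma^n_{k,l}$ and the size of its widest line by $2^{O(d)}$, so
  all three are $2^{O(d^2)}$.\<close>

subsection \<open>Formulae modulo associativity, commutativity and units\<close>

lemma eq_rule_Disj_cong: "eq_rule \<alpha> \<alpha>' \<Longrightarrow> eq_rule \<beta> \<beta>' \<Longrightarrow> eq_rule (Disj \<alpha> \<beta>) (Disj \<alpha>' \<beta>')"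
  using eq_rule.in_context[of \<alpha> \<alpha>' "DisjL Hole \<beta>"] eq_rule.in_context[of \<beta> \<beta>' "DisjR \<alpha>' Hole"]
  by (auto intro: eq_rule.trans)

lemma eq_rule_Conj_cong: "eq_rule \<alpha> \<alpha>' \<Longrightarrow> eq_rule \<beta> \<beta>' \<Longrightarrow> eq_rule (Conj \<alpha> \<beta>) (Conj \<alpha>' \<beta>')"
  using eq_rule.in_context[of \<alpha> \<alpha>' "ConjL Hole \<beta>"] eq_rule.in_context[of \<beta> \<beta>' "ConjR \<alpha>' Hole"]
  by (auto intro: eq_rule.trans)

declare eq_rule.trans [trans]

text \<open>Disjunction and conjunction need the same facts modulo \<open>=\<close>, so these are
  proved once and interpreted twice. The singleton equation keeps the unit out of nonempty lists;
  hence \<open>big_Cons\<close> below is only an instance of \<open>=\<close>, not an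
  equation.\<close>

locale formula_monoid =
  fixes f :: "'v formula \<Rightarrow> 'v formula \<Rightarrow> 'v formula" and e :: "'v formula"
    and big :: "'v formula list \<Rightarrow> 'v formula"
  assumes comm: "eq_rule (f \<alpha> \<beta>) (f \<beta> \<alpha>)"
    and assoc: "eq_rule (f (f \<alpha> \<beta>) \<gamma>) (f \<alpha> (f \<beta> \<gamma>))"
    and unit: "eq_rule (f \<alpha> e) \<alpha>"
    and cong: "eq_rule \<alpha> \<alpha>' \<Longrightarrow> eq_rule \<beta> \<beta>' \<Longrightarrow> eq_rule (f \<alpha> \<beta>) (f \<alpha>' \<beta>')"
    and big_Nil: "big [] = e"
    and big_single: "big [\<alpha>] = \<alpha>"
    and big_Cons_Cons: "big (\<alpha> # \<beta> # xs) = f \<alpha> (big (\<beta> # xs))"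
begin

lemma unit_left: "eq_rule (f e \<alpha>) \<alpha>"
  using comm unit by (rule eq_rule.trans)

lemma big_Cons: "eq_rule (big (\<alpha> # xs)) (f \<alpha> (big xs))"
  by (cases xs) (auto simp: big_Nil big_single big_Cons_Cons intro: eq_rule.intros unit)

lemma big_append: "eq_rule (big (xs @ ys)) (f (big xs) (big ys))"
proof (induction xs)
  case Nil
  show ?case by (simp add: big_Nil eq_rule.sym unit_left)
next
  case (Cons x xs)
  have "eq_rule (big ((x # xs) @ ys)) (f x (big (xs @ ys)))"
    by (simp add: big_Cons)
  also have "eq_rule \<dots> (f x (f (big xs) (big ys)))"
    by (rule cong[OF eq_rule.refl Cons.IH])
  also have "eq_rule \<dots> (f (f x (big xs)) (big ys))"
    by (rule eq_rule.sym[OF assoc])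
  also have "eq_rule \<dots> (f (big (x # xs)) (big ys))"
    by (rule cong[OF eq_rule.sym[OF big_Cons] eq_rule.refl])
  finally show ?case .
qed

lemma big_snoc: "eq_rule (big (xs @ [\<alpha>])) (f (big xs) \<alpha>)"
  using big_append[of xs "[\<alpha>]"] by (simp add: big_single)

lemma big_Cons_cong: "eq_rule (big xs) (big ys) \<Longrightarrow> eq_rule (big (x # xs)) (big (x # ys))"
  by (meson big_Cons cong eq_rule.refl eq_rule.sym eq_rule.trans)

text \<open>The head \<open>x\<close> of \<open>xs\<close> splits \<open>ys\<close> as
  \<open>us @ x # vs\<close>. The induction hypothesis applies to \<open>us @ vs\<close>, after
  which \<open>x\<close> is carried past \<open>us\<close>.\<close>

lemma big_perm:
  assumes "mset xs = mset ys"
  shows "eq_rule (big xs) (big ys)"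
  using assms
proof (induction xs arbitrary: ys)
  case Nil
  then show ?case by (simp add: eq_rule.refl)
next
  case (Cons x xs)
  from Cons.prems have "x \<in> set ys"
    by (metis list.set_intros(1) set_mset_mset)
  then obtain us vs where ys: "ys = us @ x # vs"
    by (meson split_list)
  have "eq_rule (big (x # xs)) (big ((x # us) @ vs))"
    using Cons ys by (simp add: big_Cons_cong)
  also have "eq_rule \<dots> (f (big (x # us)) (big vs))"
    by (rule big_append)
  also have "eq_rule \<dots> (f (f (big us) x) (big vs))"
    by (meson big_Cons comm cong eq_rule.refl eq_rule.trans)
  also have "eq_rule \<dots> (f (big us) (f x (big vs)))"
    by (rule assoc)
  also have "eq_rule \<dots> (f (big us) (big (x # vs)))"
    by (rule cong[OF eq_rule.refl eq_rule.sym[OF big_Cons]])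
  also have "eq_rule \<dots> (big ys)"
    unfolding ys by (rule eq_rule.sym[OF big_append])
  finally show ?case .
qed

lemma big_map_cong:
  "(\<And>x. x \<in> set xs \<Longrightarrow> eq_rule (F x) (G x)) \<Longrightarrow> eq_rule (big (map F xs)) (big (map G xs))"
proof (induction xs)
  case (Cons x xs)
  have "eq_rule (big (map F (x # xs))) (f (F x) (big (map F xs)))"
    by (simp add: big_Cons)
  also have "eq_rule \<dots> (f (G x) (big (map G xs)))"
    using Cons by (intro cong) auto
  also have "eq_rule \<dots> (big (map G (x # xs)))"
    by (simp add: big_Cons eq_rule.sym)
  finally show ?case .
qed (simp add: eq_rule.refl)

text \<open>This compares either end of \<open>Gamma\<close> with a threshold formula. The list
  \<open>xs\<close> indexes the recursive derivations, and \<open>h\<close> sends each index pair to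
  the pair it accounts for: itself at the premiss, a shifted pair at the conclusion. The list
  \<open>ys\<close> holds the at most one remaining pair, covered by the ends of
  \<open>Upsilon\<close> and \<open>Delta\<close>.\<close>

lemma big_map_partition:
  assumes "mset zs = mset (map h xs @ ys)"
    and "\<And>x. x \<in> set xs \<Longrightarrow> eq_rule (F (h x)) (G x)"
    and "eq_rule (big (map F ys)) (f \<upsilon> \<delta>)"
  shows "eq_rule (big (map F zs)) (big (map G xs @ [\<upsilon>, \<delta>]))"
proof -
  have "mset (map F zs) = mset (map F (map h xs @ ys))"
    using assms(1) by (metis mset_map)
  then have "eq_rule (big (map F zs)) (big (map (F \<circ> h) xs @ map F ys))"
    using big_perm by fastforce
  also have "eq_rule \<dots> (f (big (map (F \<circ> h) xs)) (big (map F ys)))"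
    by (rule big_append)
  also have "eq_rule \<dots> (f (big (map G xs)) (big [\<upsilon>, \<delta>]))"
    using assms(2,3) by (intro cong big_map_cong) (auto simp: big_Cons_Cons big_single)
  also have "eq_rule \<dots> (big (map G xs @ [\<upsilon>, \<delta>]))"
    by (rule eq_rule.sym[OF big_append])
  finally show ?thesis .
qed

end

interpretation disj: formula_monoid Disj Ff big_disj
  by unfold_locales (auto intro: eq_rule.intros eq_rule_Disj_cong)

interpretation conj: formula_monoid Conj Tt big_conj
  by unfold_locales (auto intro: eq_rule.intros eq_rule_Conj_cong)

section \<open>Substitution for an atom\<close>

lemma subst_big_disj: "subst a \<beta> (big_disj xs) = (if xs = [] then Ff else big_disj (map (subst a \<beta>) xs))"
  by (induction xs rule: big_disj.induct) auto

lemma subst_big_conj: "subst a \<beta> (big_conj xs) = big_conj (map (subst a \<beta>) xs)"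
  by (induction xs rule: big_conj.induct) auto

text \<open>Substitution also changes the side formulae of a context, but the resulting context does
  not depend on what fills the hole. This is the \<open>in_context\<close> case of the next
  lemma.\<close>

lemma subst_plug: "\<exists>\<xi>'. \<forall>\<gamma>. subst a \<beta> (plug \<xi> \<gamma>) = plug \<xi>' (subst a \<beta> \<gamma>)"
proof (induction \<xi>)
  case Hole
  show ?case by (rule exI[of _ Hole]) simp
next
  case (DisjL \<xi> \<delta>)
  then obtain \<xi>' where "\<forall>\<gamma>. subst a \<beta> (plug \<xi> \<gamma>) = plug \<xi>' (subst a \<beta> \<gamma>)" ..
  then show ?case by (intro exI[of _ "DisjL \<xi>' (subst a \<beta> \<delta>)"]) simp
next
  case (DisjR \<delta> \<xi>)
  then obtain \<xi>' where "\<forall>\<gamma>. subst a \<beta> (plug \<xi> \<gamma>) = plug \<xi>' (subst a \<beta> \<gamma>)" by blast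
  then show ?case by (intro exI[of _ "DisjR (subst a \<beta> \<delta>) \<xi>'"]) simp
next
  case (ConjL \<xi> \<delta>)
  then obtain \<xi>' where "\<forall>\<gamma>. subst a \<beta> (plug \<xi> \<gamma>) = plug \<xi>' (subst a \<beta> \<gamma>)" ..
  then show ?case by (intro exI[of _ "ConjL \<xi>' (subst a \<beta> \<delta>)"]) simp
next
  case (ConjR \<delta> \<xi>)
  then obtain \<xi>' where "\<forall>\<gamma>. subst a \<beta> (plug \<xi> \<gamma>) = plug \<xi>' (subst a \<beta> \<gamma>)" by blast
  then show ?case by (intro exI[of _ "ConjR (subst a \<beta> \<delta>) \<xi>'"]) simp
qed

lemma eq_rule_subst: "eq_rule \<gamma> \<delta> \<Longrightarrow> eq_rule (subst a \<beta> \<gamma>) (subst a \<beta> \<delta>)"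
proof (induction rule: eq_rule.induct)
  case (in_context \<gamma> \<delta> \<xi>)
  then show ?case using subst_plug[of a \<beta> \<xi>] by (auto intro: eq_rule.in_context)
qed (auto intro: eq_rule.intros)

subsection \<open>Threshold formulae\<close>

lemma splits_eq_concat:
  "splits k r s = concat (map (\<lambda>i. map (Pair i) (filter (\<lambda>j. i + j = k) [0..<s])) [0..<r])"
proof -
  have "concat (map (\<lambda>j. if P j then [(i, j)] else []) js) = map (Pair i) (filter P js)"
    for i :: nat and P and js :: "nat list"
    by (induction js) auto
  then show ?thesis unfolding splits_def by simp
qed

lemma set_splits: "set (splits k r s) = {(i, j). i < r \<and> j < s \<and> i + j = k}"
  by (auto simp: splits_eq_concat)

lemma distinct_splits: "distinct (splits k r s)"
  unfolding splits_eq_concat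
  by (induction r) (auto simp: distinct_map inj_on_def)

text \<open>Either component of a pair determines the other, so both projections are
  injective.\<close>

lemma length_splits: "length (splits k r s) \<le> r" "length (splits k r s) \<le> s"
proof -
  have l: "length (splits k r s) = card (set (splits k r s))"
    by (simp add: distinct_card distinct_splits)
  have "card (set (splits k r s)) \<le> card {..<r}"
    by (rule card_inj_on_le[of fst]) (auto simp: set_splits inj_on_def)
  with l show "length (splits k r s) \<le> r" by simp
  have "card (set (splits k r s)) \<le> card {..<s}"
    by (rule card_inj_on_le[of snd]) (auto simp: set_splits inj_on_def)
  with l show "length (splits k r s) \<le> s" by simp
qed

text \<open>Two lists without repetition and with the same elements have the same multiset. The
  order of the pairs is irrelevant modulo commutativity.\<close>

lemma mset_eq_splits:
  assumes "distinct xs" "set xs = {(i, j). i < r \<and> j < s \<and> i + j = k}"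
  shows "mset (splits k r s) = mset xs"
  using assms by (simp add: set_eq_iff_mset_eq_distinct[symmetric] distinct_splits set_splits)

lemma splits_eq_Nil_iff: "splits k (Suc p) (Suc q) = [] \<longleftrightarrow> p + q < k"
proof -
  have "splits k (Suc p) (Suc q) = [] \<longleftrightarrow> set (splits k (Suc p) (Suc q)) = {}"
    by simp
  also have "\<dots> \<longleftrightarrow> p + q < k"
  proof
    assume "set (splits k (Suc p) (Suc q)) = {}"
    \<comment> \<open>This pair puts as much of \<open>k\<close> as possible on the left; it is in
      range as soon as \<open>k \<le> p + q\<close>.\<close>
    then have "(min k p, k - min k p) \<notin> set (splits k (Suc p) (Suc q))" by simp
    then show "p + q < k" by (auto simp: set_splits min_def split: if_splits)
  qed (auto simp: set_splits)
  finally show ?thesis .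
qed

lemma splits_max: "splits (p + q) (Suc p) (Suc q) = [(p, q)]"
proof -
  have "mset (splits (p + q) (Suc p) (Suc q)) = mset [(p, q)]"
    by (rule mset_eq_splits) auto
  then show ?thesis by simp
qed

text \<open>For the premiss of \<open>Gamma\<close> with \<open>l \<le> p\<close>: the condition for
  a pair with \<open>i = p\<close> to exist is the one under which \<open>Upsilon\<close> is
  nontrivial. The \<open>map id\<close> fits the shape of \<open>big_map_partition\<close>.\<close>

lemma mset_splits_drop_last_left:
  "mset (splits k (Suc p) (Suc q)) =
     mset (map id (splits k p (Suc q)) @ (if p \<le> k \<and> k \<le> p + q then [(p, k - p)] else []))"
  by (rule mset_eq_splits) (auto simp: distinct_splits set_splits)

lemma mset_splits_drop_last_right:
  "mset (splits k (Suc p) (Suc q)) =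
     mset (map id (splits k (Suc p) q) @ (if q \<le> k \<and> k \<le> p + q then [(k - q, q)] else []))"
  by (rule mset_eq_splits) (auto simp: distinct_splits set_splits)

text \<open>For the conclusion of \<open>Gamma\<close> with \<open>l \<le> p\<close>: raising
  \<open>i\<close> by one reaches every pair except the one with first component 0, which is in
  range only if \<open>k < q\<close>. That pair is left to \<open>Delta\<close>.\<close>

lemma mset_splits_shift_left:
  "mset (splits (Suc k) (Suc p) (Suc q)) =
     mset (map (\<lambda>(i, j). (Suc i, j)) (splits k p (Suc q)) @ (if k < q then [(0, Suc k)] else []))"
  by (rule mset_eq_splits)
    (auto simp: distinct_splits set_splits distinct_map inj_on_def image_iff, presburger+)

lemma mset_splits_shift_right:
  "mset (splits (Suc k) (Suc p) (Suc q)) =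
     mset (map (\<lambda>(i, j). (i, Suc j)) (splits k (Suc p) q) @ (if k < p then [(Suc k, 0)] else []))"
  by (rule mset_eq_splits)
    (auto simp: distinct_splits set_splits distinct_map inj_on_def image_iff, presburger+)

section \<open>Recursive form and substitution instances of threshold formulae\<close>

lemma theta_0 [simp]: "theta 0 as = Tt"
  by (subst theta.simps) simp

lemma theta_greater: "length as < k \<Longrightarrow> theta k as = Ff"
  by (subst theta.simps) simp

lemma theta_singleton: "theta (Suc 0) [a] = Atom a"
  by (subst theta.simps) simp

lemma theta_split:
  assumes "length as \<ge> 2" "0 < k" "k \<le> length as" "p = length as div 2"
  shows "theta k as = big_disj (map (\<lambda>(i, j). Conj (theta i (take p as)) (theta j (drop p as)))
             (splits k (Suc p) (Suc (length as - p))))"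
  using assms by (subst theta.simps) (auto simp: Let_def)

lemma splits_0: "splits 0 (Suc p) (Suc q) = [(0, 0)]"
proof -
  have "mset (splits 0 (Suc p) (Suc q)) = mset [(0, 0)]"
    by (rule mset_eq_splits) auto
  then show ?thesis by simp
qed

text \<open>Modulo \<open>=\<close> the recursive clause also covers the extreme indices: at
  \<open>k = 0\<close> the only pair gives \<open>Conj Tt Tt\<close>, and above the length there is
  no pair, so the disjunction is \<open>Ff\<close>. Later arguments then need no case distinction on
  \<open>k\<close>.\<close>

lemma theta_split_eq:
  assumes "length as \<ge> 2" "p = length as div 2"
  shows "eq_rule (theta k as) (big_disj (map (\<lambda>(i, j). Conj (theta i (take p as)) (theta j (drop p as)))
             (splits k (Suc p) (Suc (length as - p)))))"
proof -
  consider "k = 0" | "length as < k" | "0 < k" "k \<le> length as"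
    by linarith
  then show ?thesis
  proof cases
    case 1
    then show ?thesis by (simp add: splits_0 eq_rule.conj_Tt eq_rule.sym)
  next
    case 2
    then have "splits k (Suc p) (Suc (length as - p)) = []"
      using assms by (simp add: splits_eq_Nil_iff)
    then show ?thesis using 2 by (simp add: theta_greater eq_rule.refl)
  qed (simp add: assms theta_split eq_rule.refl)
qed

lemma subst_theta_split_eq:
  assumes "length as \<ge> 2" "p = length as div 2"
  shows "eq_rule (subst a \<beta> (theta k as))
    (big_disj (map (\<lambda>(i, j). Conj (subst a \<beta> (theta i (take p as))) (subst a \<beta> (theta j (drop p as))))
      (splits k (Suc p) (Suc (length as - p)))))"
  using eq_rule_subst[OF theta_split_eq[OF assms], of a \<beta> k]
  by (auto simp: subst_big_disj case_prod_unfold o_def split: if_splits)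

lemma subst_theta_notin: "a \<notin> set as \<Longrightarrow> subst a \<beta> (theta k as) = theta k as"
proof (induction as arbitrary: k rule: measure_induct_rule[of length])
  case (less as)
  consider "k = 0" | "length as < k" | "k = 1" "length as = 1" | "length as \<ge> 2" "0 < k" "k \<le> length as"
    by linarith
  then show ?case
  proof cases
    case 3
    then obtain b where "as = [b]" by (auto simp: length_Suc_conv)
    then show ?thesis using less.prems 3 by (auto simp: theta_singleton)
  next
    case 4
    then have "subst a \<beta> (theta i (take (length as div 2) as)) = theta i (take (length as div 2) as)"
      "subst a \<beta> (theta i (drop (length as div 2) as)) = theta i (drop (length as div 2) as)" for i
      using less.prems by (auto intro!: less.IH dest: in_set_takeD in_set_dropD)
    then show ?thesis
      by (auto simp: theta_split[OF 4 HOL.refl] subst_big_disj case_prod_unfold o_def)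
  qed (simp_all add: theta_greater)
qed

text \<open>At the maximal index the only split is \<open>(p, q)\<close>, so no disjunction remains
  and the conjunctions of the two halves are concatenated.\<close>

lemma theta_length: "as \<noteq> [] \<Longrightarrow> eq_rule (theta (length as) as) (big_conj (map Atom as))"
proof (induction as rule: measure_induct_rule[of length])
  case (less as)
  show ?case
  proof (cases "length as \<ge> 2")
    case True
    define p where "p = length as div 2"
    define q where "q = length as - p"
    have p: "length (take p as) = p" "length (drop p as) = q" "p + q = length as" "0 < p" "0 < q"
      using True by (auto simp: p_def q_def)
    have "splits (length as) (Suc p) (Suc q) = [(p, q)]"
      using splits_max[of p q] p by simp
    then have "theta (length as) as = Conj (theta p (take p as)) (theta q (drop p as))"
      using True by (subst theta_split[of _ _ p]) (auto simp: p_def q_def)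
    also have "eq_rule \<dots> (Conj (big_conj (map Atom (take p as))) (big_conj (map Atom (drop p as))))"
      using p less.prems less.IH[of "take p as"] less.IH[of "drop p as"] by (intro conj.cong) auto
    also have "eq_rule \<dots> (big_conj (map Atom (take p as) @ map Atom (drop p as)))"
      by (rule eq_rule.sym[OF conj.big_append])
    finally show ?thesis by (simp flip: map_append)
  next
    case False
    with less.prems have "length as = 1"
      using length_greater_0_conv[of as] by linarith
    then obtain b where "as = [b]" by (auto simp: length_Suc_conv)
    then show ?thesis by (simp add: theta_singleton eq_rule.refl)
  qed
qed

text \<open>Distinctness makes the chosen atom occur exactly once in the conjunction, and the
  \<open>Ff\<close> replacing it is moved to the end. The result has the shape that
  \<open>Upsilon\<close> coweakens; here \<open>l\<close> counts from 0.\<close>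

lemma subst_theta_length:
  assumes "distinct as" "l < length as"
  shows "eq_rule (subst (as ! l) Ff (theta (length as) as))
           (Conj (big_conj (map Atom (take l as @ drop (Suc l) as))) Ff)"
proof -
  define a where "a = as ! l"
  have as: "as = take l as @ a # drop (Suc l) as"
    using assms unfolding a_def by (simp add: id_take_nth_drop)
  then have "distinct (take l as @ a # drop (Suc l) as)"
    using assms(1) by simp
  then have notin: "a \<notin> set (take l as @ drop (Suc l) as)"
    by auto
  then have *: "map (subst a Ff \<circ> Atom) (take l as) = map Atom (take l as)"
    "map (subst a Ff \<circ> Atom) (drop (Suc l) as) = map Atom (drop (Suc l) as)"
    by auto
  have "eq_rule (subst a Ff (theta (length as) as)) (subst a Ff (big_conj (map Atom as)))"
    using assms by (intro eq_rule_subst theta_length) auto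
  also have "subst a Ff (big_conj (map Atom as))
      = big_conj (map Atom (take l as) @ Ff # map Atom (drop (Suc l) as))"
    by (subst (1) as) (simp add: subst_big_conj *)
  also have "eq_rule \<dots> (big_conj (map Atom (take l as @ drop (Suc l) as) @ [Ff]))"
    by (rule conj.big_perm) simp
  also have "eq_rule \<dots> (Conj (big_conj (map Atom (take l as @ drop (Suc l) as))) Ff)"
    by (rule conj.big_snoc)
  finally show ?thesis by (simp add: a_def)
qed

subsection \<open>Derivations with atomic weakening\<close>

abbreviation aw_rules :: "'v inf_rule set" where
  "aw_rules \<equiv> {aw_down, aw_up, eq_rule}"

lemma inf_stepI: "r \<in> R \<Longrightarrow> r \<gamma> \<delta> \<Longrightarrow> inf_step R \<gamma> \<delta>"
  using inf_step.intros[of r R \<gamma> \<delta> Hole] by simp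

lemma inf_step_eq: "eq_rule \<gamma> \<delta> \<Longrightarrow> inf_step aw_rules \<gamma> \<delta>"
  by (rule inf_stepI[of eq_rule]) auto

lemma inf_step_aw_down: "inf_step aw_rules Ff (Atom a)"
  by (rule inf_stepI[of aw_down]) (auto intro: aw_down.intros)

lemma inf_step_aw_up: "inf_step aw_rules (Atom a) Tt"
  by (rule inf_stepI[of aw_up]) (auto intro: aw_up.intros)

lemma inf_step_contexts:
  assumes "inf_step R \<gamma> \<delta>"
  shows "inf_step R (Disj \<gamma> \<beta>) (Disj \<delta> \<beta>)" "inf_step R (Disj \<beta> \<gamma>) (Disj \<beta> \<delta>)"
    "inf_step R (Conj \<gamma> \<beta>) (Conj \<delta> \<beta>)" "inf_step R (Conj \<beta> \<gamma>) (Conj \<beta> \<delta>)"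
proof -
  obtain r \<xi> \<gamma>' \<delta>' where r: "r \<in> R" "r \<gamma>' \<delta>'" and "\<gamma> = plug \<xi> \<gamma>'" "\<delta> = plug \<xi> \<delta>'"
    using assms by (auto elim: inf_step.cases)
  then show "inf_step R (Disj \<gamma> \<beta>) (Disj \<delta> \<beta>)" "inf_step R (Disj \<beta> \<gamma>) (Disj \<beta> \<delta>)"
    "inf_step R (Conj \<gamma> \<beta>) (Conj \<delta> \<beta>)" "inf_step R (Conj \<beta> \<gamma>) (Conj \<beta> \<delta>)"
    using inf_step.intros[OF r, of "DisjL \<xi> \<beta>"] inf_step.intros[OF r, of "DisjR \<beta> \<xi>"]
      inf_step.intros[OF r, of "ConjL \<xi> \<beta>"] inf_step.intros[OF r, of "ConjR \<beta> \<xi>"]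
    by auto
qed

lemma derivation_trivial: "derivation R [\<alpha>] \<alpha> \<alpha>"
  by (simp add: derivation_def)

lemma derivation_Cons:
  "inf_step R \<alpha> \<beta> \<Longrightarrow> derivation R \<Phi> \<beta> \<gamma> \<Longrightarrow> derivation R (\<alpha> # \<Phi>) \<alpha> \<gamma>"
  by (cases \<Phi>) (auto simp: derivation_def)

lemma derivation_snoc:
  "derivation R \<Phi> \<alpha> \<beta> \<Longrightarrow> inf_step R \<beta> \<gamma> \<Longrightarrow> derivation R (\<Phi> @ [\<gamma>]) \<alpha> \<gamma>"
  by (auto simp: derivation_def successively_append_iff)

text \<open>Only closure of steps under both arguments of \<open>f\<close> matters, so the lemma
  serves \<open>disj_deriv\<close> and \<open>conj_deriv\<close> alike.\<close>

lemma derivation_parallel: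
  assumes "derivation R \<Phi> \<alpha> \<beta>" "derivation R \<Psi> \<gamma> \<delta>"
    and "\<And>\<phi> \<phi>' \<psi>. inf_step R \<phi> \<phi>' \<Longrightarrow> inf_step R (f \<phi> \<psi>) (f \<phi>' \<psi>)"
    and "\<And>\<phi> \<psi> \<psi>'. inf_step R \<psi> \<psi>' \<Longrightarrow> inf_step R (f \<phi> \<psi>) (f \<phi> \<psi>')"
  shows "derivation R (map (\<lambda>\<phi>. f \<phi> (hd \<Psi>)) \<Phi> @ map (f (last \<Phi>)) (tl \<Psi>)) (f \<alpha> \<gamma>) (f \<beta> \<delta>)"
proof -
  obtain \<Psi>' where \<Psi>: "\<Psi> = \<gamma> # \<Psi>'"
    using assms(2) by (cases \<Psi>) (auto simp: derivation_def)
  have "successively (inf_step R) (map (\<lambda>\<phi>. f \<phi> \<gamma>) \<Phi>)"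
    using assms(1) by (auto simp: derivation_def successively_map intro: successively_mono assms(3))
  \<comment> \<open>The formula \<open>f \<beta> \<gamma>\<close> already ends the first phase.
    Putting it back in front of the second phase supplies the step across the seam.\<close>
  moreover have "successively (inf_step R) (map (f \<beta>) (\<gamma> # \<Psi>'))"
    using assms(2) unfolding successively_map \<Psi>
    by (auto simp: derivation_def intro: successively_mono assms(4))
  ultimately show ?thesis
    using assms(1,2) \<Psi>
    by (cases \<Psi>') (auto simp: derivation_def successively_append_iff hd_map last_map)
qed

lemma derivation_disj_deriv:
  "derivation R \<Phi> \<alpha> \<beta> \<Longrightarrow> derivation R \<Psi> \<gamma> \<delta> \<Longrightarrow> derivation R (disj_deriv \<Phi> \<Psi>) (Disj \<alpha> \<gamma>) (Disj \<beta> \<delta>)"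
  unfolding disj_deriv_def by (rule derivation_parallel) (auto intro: inf_step_contexts)

lemma derivation_conj_deriv:
  "derivation R \<Phi> \<alpha> \<beta> \<Longrightarrow> derivation R \<Psi> \<gamma> \<delta> \<Longrightarrow> derivation R (conj_deriv \<Phi> \<Psi>) (Conj \<alpha> \<gamma>) (Conj \<beta> \<delta>)"
  unfolding conj_deriv_def by (rule derivation_parallel) (auto intro: inf_step_contexts)

lemma derivation_big_disj_deriv_append:
  assumes "\<And>x. x \<in> set xs \<Longrightarrow> derivation R (\<Phi> x) (\<alpha> x) (\<beta> x)"
    and "derivation R \<Upsilon> \<gamma> \<delta>" "derivation R \<Delta> \<epsilon> \<zeta>"
  shows "derivation R (big_disj_deriv (map \<Phi> xs @ [\<Upsilon>, \<Delta>]))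
    (big_disj (map \<alpha> xs @ [\<gamma>, \<epsilon>])) (big_disj (map \<beta> xs @ [\<delta>, \<zeta>]))"
  using assms
proof (induction xs)
  case Nil
  then show ?case by (simp add: derivation_disj_deriv)
next
  case (Cons x xs)
  then show ?case by (cases xs) (auto intro: derivation_disj_deriv)
qed

text \<open>In the binary cases the opening step is an instance of \<open>=\<close>, splitting
  \<open>Ff\<close> into \<open>Disj Ff Ff\<close> or \<open>Conj Ff Ff\<close>; the components are
  then weakened in turn.\<close>

lemma derivation_weaken: "derivation aw_rules (weaken b \<alpha>) Ff \<alpha>"
proof (induction \<alpha>)
  case (Disj \<alpha> \<beta>)
  then show ?case
    by (auto intro!: derivation_Cons[OF _ derivation_disj_deriv] inf_step_eq intro: eq_rule.intros)
next
  case (Conj \<alpha> \<beta>)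
  then show ?case
    by (auto intro!: derivation_Cons[OF _ derivation_conj_deriv] inf_step_eq intro: eq_rule.intros)
qed (auto simp: derivation_def inf_step_aw_down inf_step_aw_up)

text \<open>Dually, a closing \<open>=\<close> step collapses \<open>Disj Tt Tt\<close> or
  \<open>Conj Tt Tt\<close> to \<open>Tt\<close>.\<close>

lemma derivation_coweaken: "derivation aw_rules (coweaken b \<alpha>) \<alpha> Tt"
proof (induction \<alpha>)
  case (Disj \<alpha> \<beta>)
  then show ?case
    by (auto intro!: derivation_snoc[OF derivation_disj_deriv] inf_step_eq intro: eq_rule.intros)
next
  case (Conj \<alpha> \<beta>)
  then show ?case
    by (auto intro!: derivation_snoc[OF derivation_conj_deriv] inf_step_eq intro: eq_rule.intros)
qed (auto simp: derivation_def inf_step_aw_down inf_step_aw_up)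

text \<open>The threshold formula of the other half joins the conjuncts beside \<open>Ff\<close>, so
  that one coweakening removes all of them. The placement of \<open>\<tau>\<close> in the list
  follows the two branches of \<open>Upsilon\<close>.\<close>

lemma
  assumes "eq_rule \<alpha> (Conj (big_conj xs) Ff)"
  shows Conj_pull_Ff_left: "eq_rule (Conj \<alpha> \<tau>) (Conj (big_conj (xs @ [\<tau>])) Ff)"
    and Conj_pull_Ff_right: "eq_rule (Conj \<tau> \<alpha>) (Conj (big_conj (\<tau> # xs)) Ff)"
proof -
  have "eq_rule (Conj \<tau> \<alpha>) (Conj \<tau> (Conj (big_conj xs) Ff))"
    by (rule conj.cong[OF eq_rule.refl assms])
  also have "eq_rule \<dots> (Conj (Conj \<tau> (big_conj xs)) Ff)"
    by (rule eq_rule.sym[OF eq_rule.conj_assoc])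
  also have "eq_rule \<dots> (Conj (big_conj (\<tau> # xs)) Ff)"
    by (rule conj.cong[OF eq_rule.sym[OF conj.big_Cons] eq_rule.refl])
  finally show right: "eq_rule (Conj \<tau> \<alpha>) (Conj (big_conj (\<tau> # xs)) Ff)" .
  have "eq_rule (Conj \<alpha> \<tau>) (Conj \<tau> \<alpha>)"
    by (rule eq_rule.conj_comm)
  also note right
  also have "eq_rule (Conj (big_conj (\<tau> # xs)) Ff) (Conj (big_conj (xs @ [\<tau>])) Ff)"
    by (intro conj.cong conj.big_perm eq_rule.refl) simp
  finally show "eq_rule (Conj \<alpha> \<tau>) (Conj (big_conj (xs @ [\<tau>])) Ff)" .
qed

text \<open>Coweakening the first conjunct leaves \<open>Conj Tt Ff\<close>, which equals
  \<open>Ff\<close> by the unit law. Both nontrivial branches of \<open>Upsilon\<close> have this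
  form.\<close>

lemma derivation_coweaken_Conj_Ff:
  assumes "eq_rule \<alpha> (Conj \<gamma> Ff)"
  shows "derivation aw_rules ([\<alpha>] @ conj_deriv (coweaken b \<gamma>) [Ff] @ [Ff]) \<alpha> Ff"
proof -
  have "eq_rule (Conj Tt Ff) Ff" by (rule conj.unit_left)
  with derivation_conj_deriv[OF derivation_coweaken derivation_trivial]
  have "derivation aw_rules (conj_deriv (coweaken b \<gamma>) [Ff] @ [Ff]) (Conj \<gamma> Ff) Ff"
    by (rule derivation_snoc[OF _ inf_step_eq])
  with assms show ?thesis by (auto intro: derivation_Cons inf_step_eq)
qed

text \<open>The premiss is written as the disjunct for the pair \<open>(p, k - p)\<close>, or as
  \<open>Ff\<close> if that pair is out of range, to match the pair missing from the recursive
  part.\<close>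

lemma derivation_Upsilon_left:
  assumes "distinct as" "p = length as div 2" "1 \<le> l" "l \<le> p"
  shows "derivation aw_rules (Upsilon k l as)
    (if p \<le> k \<and> k \<le> length as
     then Conj (subst (as ! (l - 1)) Ff (theta p (take p as))) (theta (k - p) (drop p as)) else Ff) Ff"
proof (cases "p \<le> k \<and> k \<le> length as")
  case True
  have "eq_rule (subst (take p as ! (l - 1)) Ff (theta p (take p as)))
      (Conj (big_conj (map Atom (take (l - 1) (take p as) @ drop l (take p as)))) Ff)"
    using subst_theta_length[of "take p as" "l - 1"] assms by simp
  then have "eq_rule (subst (as ! (l - 1)) Ff (theta p (take p as)))
      (Conj (big_conj (map Atom (take (l - 1) (take p as) @ drop l (take p as)))) Ff)"
    using assms by simp
  from derivation_coweaken_Conj_Ff[OF Conj_pull_Ff_left[OF this]] show ?thesis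
    using True assms by (simp add: Upsilon_def Let_def)
qed (use assms in \<open>auto simp: Upsilon_def Let_def derivation_trivial\<close>)

lemma derivation_Upsilon_right:
  assumes "distinct as" "p = length as div 2" "q = length as - p" "p < l" "l \<le> length as"
  shows "derivation aw_rules (Upsilon k l as)
    (if q \<le> k \<and> k \<le> length as
     then Conj (theta (k - q) (take p as)) (subst (as ! (l - 1)) Ff (theta q (drop p as))) else Ff) Ff"
proof (cases "q \<le> k \<and> k \<le> length as")
  case True
  have "eq_rule (subst (drop p as ! (l - p - 1)) Ff (theta q (drop p as)))
      (Conj (big_conj (map Atom (take (l - p - 1) (drop p as) @ drop (l - p) (drop p as)))) Ff)"
    using subst_theta_length[of "drop p as" "l - p - 1"] assms by (simp add: Suc_diff_Suc del: drop_drop)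
  moreover have "drop p as ! (l - p - 1) = as ! (l - 1)"
    using assms by simp
  ultimately have "eq_rule (subst (as ! (l - 1)) Ff (theta q (drop p as)))
      (Conj (big_conj (map Atom (take (l - p - 1) (drop p as) @ drop (l - p) (drop p as)))) Ff)"
    by simp
  from derivation_coweaken_Conj_Ff[OF Conj_pull_Ff_right[OF this]] show ?thesis
    using True assms by (simp add: Upsilon_def Let_def del: drop_drop)
qed (use assms in \<open>auto simp: Upsilon_def Let_def derivation_trivial\<close>)

text \<open>The index supplied by \<open>Gamma\<close> is \<open>Suc k\<close>, so the range
  \<open>0 < Suc k \<le> q\<close> becomes \<open>k < q\<close>.\<close>

lemma derivation_Delta_left:
  assumes "p = length as div 2" "l \<le> p"
  shows "derivation aw_rules (Delta (Suc k) l as) Ff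
    (if k < length as - p then theta (Suc k) (drop p as) else Ff)"
  using assms by (auto simp: Delta_def Let_def derivation_weaken derivation_trivial)

lemma derivation_Delta_right:
  assumes "p = length as div 2" "p < l"
  shows "derivation aw_rules (Delta (Suc k) l as) Ff
    (if k < p then theta (Suc k) (take p as) else Ff)"
  using assms by (auto simp: Delta_def Let_def derivation_weaken derivation_trivial)

section \<open>The recursion for \<open>Gamma\<close> and the ends of the derivation\<close>

lemma Gamma_left:
  assumes "length as \<ge> 2" "k \<le> length as" "p = length as div 2" "l \<le> p"
  shows "Gamma k l as = big_disj_deriv
    (map (\<lambda>(i, j). conj_deriv (Gamma i l (take p as)) [theta j (drop p as)])
       (splits k p (Suc (length as - p))) @ [Upsilon k l as, Delta (Suc k) l as])"
  using assms by (subst Gamma.simps) (auto simp: Let_def)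

lemma Gamma_right:
  assumes "length as \<ge> 2" "k \<le> length as" "p = length as div 2" "p < l"
  shows "Gamma k l as = big_disj_deriv
    (map (\<lambda>(i, j). conj_deriv [theta i (take p as)] (Gamma j (l - p) (drop p as)))
       (splits k (Suc p) (length as - p)) @ [Upsilon k l as, Delta (Suc k) l as])"
  using assms by (subst Gamma.simps) (auto simp: Let_def)

lemma Gamma_greater: "length as < k \<Longrightarrow> Gamma k l as = [Ff]"
  by (subst Gamma.simps) (simp add: Let_def)

lemma Gamma_singleton: "Gamma k l [a] = (if k = 0 then [Tt] else [Ff])"
  by (subst Gamma.simps) (simp add: Let_def)

lemma derivation_hd_last: "derivation R \<Phi> \<alpha> \<beta> \<Longrightarrow> hd \<Phi> = \<alpha> \<and> last \<Phi> = \<beta>"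
  by (simp add: derivation_def)

lemma Gamma_correct:
  assumes "distinct as" "1 \<le> l" "l \<le> length as"
  shows "derivation aw_rules (Gamma k l as) (hd (Gamma k l as)) (last (Gamma k l as)) \<and>
    eq_rule (subst (as ! (l - 1)) Ff (theta k as)) (hd (Gamma k l as)) \<and>
    eq_rule (last (Gamma k l as)) (subst (as ! (l - 1)) Tt (theta (Suc k) as))"
  using assms
proof (induction as arbitrary: k l rule: measure_induct_rule[of length])
  case (less as)
  define p where "p = length as div 2"
  define q where "q = length as - p"
  define a where "a = as ! (l - 1)"
  consider "length as < k" | "length as = 1" | "length as \<ge> 2" "k \<le> length as" "l \<le> p"
    | "length as \<ge> 2" "k \<le> length as" "p < l"
    using less.prems by linarith
  then show ?case
  proof cases
    case 1
    then show ?thesis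
      by (simp add: Gamma_greater theta_greater derivation_trivial eq_rule.refl)
  next
    case 2
    then obtain b where "as = [b]" by (auto simp: length_Suc_conv)
    moreover have "l = 1" using 2 less.prems by simp
    \<comment> \<open>For one atom the derivation is trivial. At \<open>k = 0\<close> both ends are
      \<open>Tt\<close>, since the conclusion is the atom replaced by \<open>Tt\<close>; at
      \<open>k = 1\<close> the premiss is the atom replaced by \<open>Ff\<close> and the conclusion
      is out of range; beyond that both ends are out of range.\<close>
    moreover have "k = 0 \<or> k = 1 \<or> k > 1" by linarith
    ultimately show ?thesis
      by (auto simp: Gamma_singleton theta_singleton theta_greater derivation_trivial eq_rule.refl)
  next
    case 3
    define G where "G i = Gamma i l (take p as)" for i
    have pq: "p + q = length as" "0 < p" "0 < q" "length (take p as) = p" "length (drop p as) = q"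
      using 3 by (auto simp: p_def q_def)
    have a: "a = take p as ! (l - 1)"
      using 3 less.prems by (simp add: a_def)
    moreover have "l - 1 < length (take p as)"
      using 3 less.prems pq by linarith
    ultimately have "a \<in> set (take p as)"
      by (metis nth_mem)
    \<comment> \<open>The chosen atom lies in the left half only, so substitution leaves the right
      factors alone.\<close>
    then have "a \<notin> set (drop p as)"
      using set_take_disj_set_drop_if_distinct[OF less.prems(1), of p p] by auto
    note subst_drop = subst_theta_notin[OF this]
    have IH: "derivation aw_rules (G i) (hd (G i)) (last (G i))"
      "eq_rule (subst a Ff (theta i (take p as))) (hd (G i))"
      "eq_rule (last (G i)) (subst a Tt (theta (Suc i) (take p as)))" for i
      using less.IH[of "take p as" l i] less.prems 3 pq by (auto simp: a G_def)
    define \<upsilon> where "\<upsilon> = (if p \<le> k \<and> k \<le> p + q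
      then Conj (subst a Ff (theta p (take p as))) (theta (k - p) (drop p as)) else Ff)"
    define \<delta> where "\<delta> = (if k < q then theta (Suc k) (drop p as) else Ff)"
    \<comment> \<open>\<open>Upsilon\<close> ends in \<open>Ff\<close> and \<open>Delta\<close>
      begins with \<open>Ff\<close>, so at each end one of the last two disjuncts is a unit.\<close>
    have "derivation aw_rules (Gamma k l as)
      (big_disj (map (\<lambda>(i, j). Conj (hd (G i)) (theta j (drop p as))) (splits k p (Suc q)) @ [\<upsilon>, Ff]))
      (big_disj (map (\<lambda>(i, j). Conj (last (G i)) (theta j (drop p as))) (splits k p (Suc q)) @ [Ff, \<delta>]))"
      unfolding Gamma_left[OF 3(1,2) p_def 3(3)] q_def[symmetric]
    proof (rule derivation_big_disj_deriv_append)
      show "derivation aw_rules (Upsilon k l as) \<upsilon> Ff"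
        unfolding \<upsilon>_def a_def pq(1)
        by (rule derivation_Upsilon_left[OF less.prems(1) p_def less.prems(2) 3(3)])
      show "derivation aw_rules (Delta (Suc k) l as) Ff \<delta>"
        using derivation_Delta_left[OF p_def 3(3), of k] by (simp add: \<delta>_def q_def)
    qed (auto intro!: derivation_conj_deriv derivation_trivial IH(1)[unfolded G_def] simp: G_def)
    note der = this
    have "eq_rule (subst a Ff (theta k as)) (big_disj
        (map (\<lambda>(i, j). Conj (subst a Ff (theta i (take p as))) (subst a Ff (theta j (drop p as))))
          (splits k (Suc p) (Suc q))))"
      unfolding q_def by (rule subst_theta_split_eq[OF 3(1) p_def])
    also have "eq_rule \<dots>
      (big_disj (map (\<lambda>(i, j). Conj (hd (G i)) (theta j (drop p as))) (splits k p (Suc q)) @ [\<upsilon>, Ff]))"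
      by (rule disj.big_map_partition[OF mset_splits_drop_last_left])
        (auto simp: \<upsilon>_def subst_drop intro!: conj.cong IH eq_rule.refl eq_rule.sym[OF disj.unit])
    finally have premiss: "eq_rule (subst a Ff (theta k as)) \<dots>" .
    have "eq_rule (subst a Tt (theta (Suc k) as)) (big_disj
        (map (\<lambda>(i, j). Conj (subst a Tt (theta i (take p as))) (subst a Tt (theta j (drop p as))))
          (splits (Suc k) (Suc p) (Suc q))))"
      unfolding q_def by (rule subst_theta_split_eq[OF 3(1) p_def])
    \<comment> \<open>By the induction hypothesis the recursive derivation for \<open>i\<close> ends
      in the threshold formula of index \<open>Suc i\<close>, which turns splits of \<open>k\<close>
      into splits of \<open>Suc k\<close>. In the missing pair \<open>(0, Suc k)\<close> the factor
      \<open>Tt\<close> disappears by the unit law.\<close>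
    also have "eq_rule \<dots>
      (big_disj (map (\<lambda>(i, j). Conj (last (G i)) (theta j (drop p as))) (splits k p (Suc q)) @ [Ff, \<delta>]))"
      by (rule disj.big_map_partition[OF mset_splits_shift_left])
        (auto simp: \<delta>_def subst_drop
          intro!: conj.cong IH(3)[THEN eq_rule.sym] eq_rule.refl eq_rule.sym[OF disj.unit]
            eq_rule.trans[OF conj.unit_left] eq_rule.sym[OF disj.unit_left])
    finally have conclusion: "eq_rule (subst a Tt (theta (Suc k) as)) \<dots>" .
    show ?thesis
      using derivation_hd_last[OF der] der premiss eq_rule.sym[OF conclusion] by (simp add: a_def)
  next
    case 4
    define G where "G j = Gamma j (l - p) (drop p as)" for j
    have pq: "p + q = length as" "0 < p" "0 < q" "length (take p as) = p" "length (drop p as) = q"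
      using 4 by (auto simp: p_def q_def)
    \<comment> \<open>Within the right half the chosen atom has position \<open>l - p\<close>,
      counted from 1.\<close>
    have a: "a = drop p as ! (l - p - 1)"
      using 4 less.prems by (simp add: a_def)
    moreover have "l - p - 1 < length (drop p as)"
      using 4 less.prems by simp
    ultimately have "a \<in> set (drop p as)"
      by (metis nth_mem)
    then have "a \<notin> set (take p as)"
      using set_take_disj_set_drop_if_distinct[OF less.prems(1), of p p] by auto
    note subst_take = subst_theta_notin[OF this]
    have IH: "derivation aw_rules (G j) (hd (G j)) (last (G j))"
      "eq_rule (subst a Ff (theta j (drop p as))) (hd (G j))"
      "eq_rule (last (G j)) (subst a Tt (theta (Suc j) (drop p as)))" for j
      using less.IH[of "drop p as" "l - p" j] less.prems 4 pq by (auto simp: a G_def)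
    define \<upsilon> where "\<upsilon> = (if q \<le> k \<and> k \<le> p + q
      then Conj (theta (k - q) (take p as)) (subst a Ff (theta q (drop p as))) else Ff)"
    define \<delta> where "\<delta> = (if k < p then theta (Suc k) (take p as) else Ff)"
    have "derivation aw_rules (Gamma k l as)
      (big_disj (map (\<lambda>(i, j). Conj (theta i (take p as)) (hd (G j))) (splits k (Suc p) q) @ [\<upsilon>, Ff]))
      (big_disj (map (\<lambda>(i, j). Conj (theta i (take p as)) (last (G j))) (splits k (Suc p) q) @ [Ff, \<delta>]))"
      unfolding Gamma_right[OF 4(1,2) p_def 4(3)] q_def[symmetric]
    proof (rule derivation_big_disj_deriv_append)
      show "derivation aw_rules (Upsilon k l as) \<upsilon> Ff"
        unfolding \<upsilon>_def a_def pq(1)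
        by (rule derivation_Upsilon_right[OF less.prems(1) p_def q_def 4(3) less.prems(3)])
      show "derivation aw_rules (Delta (Suc k) l as) Ff \<delta>"
        using derivation_Delta_right[OF p_def 4(3), of k] by (simp add: \<delta>_def)
    qed (auto intro!: derivation_conj_deriv derivation_trivial IH(1)[unfolded G_def] simp: G_def)
    note der = this
    have "eq_rule (subst a Ff (theta k as)) (big_disj
        (map (\<lambda>(i, j). Conj (subst a Ff (theta i (take p as))) (subst a Ff (theta j (drop p as))))
          (splits k (Suc p) (Suc q))))"
      unfolding q_def by (rule subst_theta_split_eq[OF 4(1) p_def])
    also have "eq_rule \<dots>
      (big_disj (map (\<lambda>(i, j). Conj (theta i (take p as)) (hd (G j))) (splits k (Suc p) q) @ [\<upsilon>, Ff]))"
      by (rule disj.big_map_partition[OF mset_splits_drop_last_right])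
        (auto simp: \<upsilon>_def subst_take intro!: conj.cong IH eq_rule.refl eq_rule.sym[OF disj.unit])
    finally have premiss: "eq_rule (subst a Ff (theta k as)) \<dots>" .
    have "eq_rule (subst a Tt (theta (Suc k) as)) (big_disj
        (map (\<lambda>(i, j). Conj (subst a Tt (theta i (take p as))) (subst a Tt (theta j (drop p as))))
          (splits (Suc k) (Suc p) (Suc q))))"
      unfolding q_def by (rule subst_theta_split_eq[OF 4(1) p_def])
    \<comment> \<open>Here the second component is raised, and the missing pair is
      \<open>(Suc k, 0)\<close>, with \<open>Tt\<close> as its right factor.\<close>
    also have "eq_rule \<dots>
      (big_disj (map (\<lambda>(i, j). Conj (theta i (take p as)) (last (G j))) (splits k (Suc p) q) @ [Ff, \<delta>]))"
      by (rule disj.big_map_partition[OF mset_splits_shift_right])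
        (auto simp: \<delta>_def subst_take
          intro!: conj.cong IH(3)[THEN eq_rule.sym] eq_rule.refl eq_rule.sym[OF disj.unit]
            eq_rule.trans[OF conj.unit] eq_rule.sym[OF disj.unit_left])
    finally have conclusion: "eq_rule (subst a Tt (theta (Suc k) as)) \<dots>" .
    show ?thesis
      using derivation_hd_last[OF der] der premiss eq_rule.sym[OF conclusion] by (simp add: a_def)
  qed
qed

subsection \<open>Size\<close>

text \<open>Number of lines and width are tracked separately because both are subadditive under
  parallel composition; their product bounds the size. Nonemptiness makes \<open>hd\<close> and
  \<open>last\<close> genuine lines.\<close>

definition deriv_bound :: "nat \<Rightarrow> nat \<Rightarrow> 'v deriv \<Rightarrow> bool" where
  "deriv_bound N M \<Phi> \<longleftrightarrow> \<Phi> \<noteq> [] \<and> length \<Phi> \<le> N \<and> (\<forall>\<gamma>\<in>set \<Phi>. formula_size \<gamma> \<le> M)"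

lemma deriv_bound_mono: "deriv_bound N M \<Phi> \<Longrightarrow> N \<le> N' \<Longrightarrow> M \<le> M' \<Longrightarrow> deriv_bound N' M' \<Phi>"
  by (auto simp: deriv_bound_def)

lemma sum_list_map_le:
  fixes f :: "'a \<Rightarrow> nat"
  assumes "\<And>x. x \<in> set xs \<Longrightarrow> f x \<le> m"
  shows "sum_list (map f xs) \<le> length xs * m"
  using assms by (induction xs) (auto intro: add_mono)

lemma deriv_size_le: "deriv_bound N M \<Phi> \<Longrightarrow> deriv_size \<Phi> \<le> N * M"
  unfolding deriv_bound_def deriv_size_def
  by (meson order_trans sum_list_map_le mult_le_mono1)

lemma deriv_bound_single: "formula_size \<alpha> \<le> M \<Longrightarrow> deriv_bound 1 M [\<alpha>]"
  by (simp add: deriv_bound_def)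

lemma deriv_bound_Cons:
  "deriv_bound N M \<Phi> \<Longrightarrow> formula_size \<alpha> \<le> M \<Longrightarrow> deriv_bound (Suc N) M (\<alpha> # \<Phi>)"
  by (simp add: deriv_bound_def)

lemma deriv_bound_snoc:
  "deriv_bound N M \<Phi> \<Longrightarrow> formula_size \<alpha> \<le> M \<Longrightarrow> deriv_bound (Suc N) M (\<Phi> @ [\<alpha>])"
  by (auto simp: deriv_bound_def)

text \<open>The two phases share the line at the seam, which saves one line.\<close>

lemma deriv_bound_parallel:
  assumes "deriv_bound N M \<Phi>" "deriv_bound N' M' \<Psi>"
    and "\<And>\<phi> \<psi>. formula_size (f \<phi> \<psi>) = formula_size \<phi> + formula_size \<psi>"
  shows "deriv_bound (N + N' - 1) (M + M') (map (\<lambda>\<phi>. f \<phi> (hd \<Psi>)) \<Phi> @ map (f (last \<Phi>)) (tl \<Psi>))"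
proof -
  obtain \<psi> \<Psi>' where \<Psi>: "\<Psi> = \<psi> # \<Psi>'"
    using assms(2) by (cases \<Psi>) (auto simp: deriv_bound_def)
  have "last \<Phi> \<in> set \<Phi>"
    using assms(1) by (simp add: deriv_bound_def)
  then show ?thesis
    using assms unfolding \<Psi> by (auto simp: deriv_bound_def intro!: add_mono)
qed

lemma deriv_bound_disj_deriv:
  "deriv_bound N M \<Phi> \<Longrightarrow> deriv_bound N' M' \<Psi> \<Longrightarrow> deriv_bound (N + N' - 1) (M + M') (disj_deriv \<Phi> \<Psi>)"
  unfolding disj_deriv_def by (rule deriv_bound_parallel) auto

lemma deriv_bound_conj_deriv:
  "deriv_bound N M \<Phi> \<Longrightarrow> deriv_bound N' M' \<Psi> \<Longrightarrow> deriv_bound (N + N' - 1) (M + M') (conj_deriv \<Phi> \<Psi>)"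
  unfolding conj_deriv_def by (rule deriv_bound_parallel) auto

text \<open>The line saved by each composition is discarded, leaving bounds linear in
  \<open>length xs\<close>.\<close>

lemma deriv_bound_big_disj_deriv_append:
  assumes "\<And>x. x \<in> set xs \<Longrightarrow> deriv_bound N M (\<Phi> x)"
    and "deriv_bound N\<^sub>1 M\<^sub>1 \<Upsilon>" "deriv_bound N\<^sub>2 M\<^sub>2 \<Delta>"
  shows "deriv_bound (length xs * N + (N\<^sub>1 + N\<^sub>2)) (length xs * M + (M\<^sub>1 + M\<^sub>2))
    (big_disj_deriv (map \<Phi> xs @ [\<Upsilon>, \<Delta>]))"
  using assms(1)
proof (induction xs)
  case Nil
  have "deriv_bound (N\<^sub>1 + N\<^sub>2 - 1) (M\<^sub>1 + M\<^sub>2) (disj_deriv \<Upsilon> \<Delta>)"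
    by (rule deriv_bound_disj_deriv[OF assms(2,3)])
  then show ?case by (auto elim: deriv_bound_mono)
next
  case (Cons x xs)
  have "deriv_bound N M (\<Phi> x)"
    "deriv_bound (length xs * N + (N\<^sub>1 + N\<^sub>2)) (length xs * M + (M\<^sub>1 + M\<^sub>2))
      (big_disj_deriv (map \<Phi> xs @ [\<Upsilon>, \<Delta>]))"
    using Cons by auto
  from deriv_bound_disj_deriv[OF this] show ?case
    by (cases xs) (auto elim!: deriv_bound_mono)
qed

section \<open>Sizes of formulae, weakenings and coweakenings\<close>

lemma formula_size_pos: "0 < formula_size \<alpha>"
  by (induction \<alpha>) auto

lemma formula_size_subst:
  "formula_size \<beta> = 1 \<Longrightarrow> formula_size (subst a \<beta> \<alpha>) = formula_size \<alpha>"
  by (induction \<alpha>) auto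

lemma formula_size_big_conj:
  "xs \<noteq> [] \<Longrightarrow> formula_size (big_conj xs) = sum_list (map formula_size xs)"
  by (induction xs rule: big_conj.induct) auto

lemma formula_size_big_disj:
  "xs \<noteq> [] \<Longrightarrow> formula_size (big_disj xs) = sum_list (map formula_size xs)"
  by (induction xs rule: big_disj.induct) auto

text \<open>The factor 3 comes from \<open>Tt\<close>, which takes three lines. In the binary cases
  the line saved at the seam pays for the opening \<open>=\<close> step.\<close>

lemma deriv_bound_weaken: "deriv_bound (3 * formula_size \<alpha>) (formula_size \<alpha>) (weaken b \<alpha>)"
proof (induction \<alpha>)
  case (Disj \<alpha> \<beta>)
  then show ?case
    using deriv_bound_Cons[OF deriv_bound_disj_deriv[OF Disj.IH], of Ff] formula_size_pos[of \<alpha>]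
    by (auto elim!: deriv_bound_mono)
next
  case (Conj \<alpha> \<beta>)
  then show ?case
    using deriv_bound_Cons[OF deriv_bound_conj_deriv[OF Conj.IH], of Ff] formula_size_pos[of \<alpha>]
    by (auto elim!: deriv_bound_mono)
qed (auto simp: deriv_bound_def)

lemma deriv_bound_coweaken: "deriv_bound (3 * formula_size \<alpha>) (formula_size \<alpha>) (coweaken b \<alpha>)"
proof (induction \<alpha>)
  case (Disj \<alpha> \<beta>)
  then show ?case
    using deriv_bound_snoc[OF deriv_bound_disj_deriv[OF Disj.IH], of Tt] formula_size_pos[of \<alpha>]
    by (auto elim!: deriv_bound_mono)
next
  case (Conj \<alpha> \<beta>)
  then show ?case
    using deriv_bound_snoc[OF deriv_bound_conj_deriv[OF Conj.IH], of Tt] formula_size_pos[of \<alpha>]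
    by (auto elim!: deriv_bound_mono)
qed (auto simp: deriv_bound_def)

text \<open>Passing from \<open>d\<close> to \<open>Suc d\<close> gives at most
  \<open>2 ^ Suc d\<close> disjuncts, each made of two formulae within the previous bound. The
  exponent thus needs to grow by \<open>d + 2\<close>, and it grows by
  \<open>2 * d + 2\<close>.\<close>

lemma formula_size_theta:
  "length as \<le> 2 ^ d \<Longrightarrow> formula_size (theta k as) \<le> 2 ^ (d * (d + 1))"
proof (induction d arbitrary: k as)
  case 0
  then have "as = [] \<or> (\<exists>a. as = [a])" by (cases as) auto
  moreover have "k = 0 \<or> k = 1 \<or> k > 1" by linarith
  ultimately show ?case
    by (auto simp: theta_singleton theta_greater)
next
  case (Suc d)
  consider "k = 0" | "length as < k" | "as = []" | a where "as = [a]" "k = 1"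
    | "length as \<ge> 2" "0 < k" "k \<le> length as"
    by (metis One_nat_def Suc_1 Suc_leI length_0_conv length_Suc_conv less_2_cases not_less
        gr0I le_SucE le_zero_eq linorder_neqE_nat)
  then show ?case
  proof cases
    case 3
    then show ?thesis by (cases "k = 0") (auto simp: theta_greater)
  next
    case 5
    define p where "p = length as div 2"
    define q where "q = length as - p"
    have p: "length (take p as) \<le> 2 ^ d" "length (drop p as) \<le> 2 ^ d" "k \<le> p + q"
      "Suc p \<le> 2 ^ Suc d"
      using Suc.prems 5 by (auto simp: p_def q_def)
    have ne: "splits k (Suc p) (Suc q) \<noteq> []"
      using p by (simp add: splits_eq_Nil_iff)
    let ?F = "\<lambda>(i, j). Conj (theta i (take p as)) (theta j (drop p as))"
    have "formula_size (theta k as)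
        = sum_list (map (\<lambda>x. formula_size (?F x)) (splits k (Suc p) (Suc q)))"
      using ne unfolding theta_split[OF 5 p_def] q_def[symmetric]
      by (subst formula_size_big_disj) (simp_all add: o_def)
    also have "\<dots> \<le> length (splits k (Suc p) (Suc q)) * (2 * 2 ^ (d * (d + 1)))"
    proof (rule sum_list_map_le, clarify)
      fix i j
      show "formula_size (Conj (theta i (take p as)) (theta j (drop p as))) \<le> 2 * 2 ^ (d * (d + 1))"
        using Suc.IH[OF p(1), of i] Suc.IH[OF p(2), of j] by simp
    qed
    also have "\<dots> \<le> 2 ^ Suc d * (2 * 2 ^ (d * (d + 1)))"
      using length_splits(1)[of k "Suc p" "Suc q"] p(4) by (intro mult_le_mono1) linarith
    also have "\<dots> = 2 ^ (Suc d + (1 + d * (d + 1)))"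
      by (simp only: power_add power_one_right)
    also have "\<dots> \<le> 2 ^ (Suc d * (Suc d + 1))"
      by (rule power_increasing) auto
    finally show ?thesis .
  qed (simp_all add: theta_greater theta_singleton)
qed

text \<open>The strict inequality leaves room for the conjunct \<open>Ff\<close> in each line and
  for the two lines added at the ends.\<close>

lemma deriv_bound_coweaken_Conj_Ff:
  assumes "formula_size \<alpha> \<le> M" "formula_size \<gamma> < M"
  shows "deriv_bound (3 * M) M ([\<alpha>] @ conj_deriv (coweaken b \<gamma>) [Ff] @ [Ff])"
proof -
  have "deriv_bound (3 * formula_size \<gamma> + 1 - 1) (formula_size \<gamma> + 1) (conj_deriv (coweaken b \<gamma>) [Ff])"
    by (intro deriv_bound_conj_deriv deriv_bound_coweaken deriv_bound_single) simp
  then have "deriv_bound (3 * formula_size \<gamma>) M (conj_deriv (coweaken b \<gamma>) [Ff])"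
    by (rule deriv_bound_mono) (use assms in auto)
  then have "deriv_bound (Suc (Suc (3 * formula_size \<gamma>))) M ([\<alpha>] @ conj_deriv (coweaken b \<gamma>) [Ff] @ [Ff])"
    using assms by (auto intro!: deriv_bound_Cons deriv_bound_snoc)
  then show ?thesis
    by (rule deriv_bound_mono) (use assms in auto)
qed

lemma formula_size_big_conj_Atoms:
  "formula_size (big_conj (map Atom as @ [\<tau>])) = length as + formula_size \<tau>"
  "formula_size (big_conj (\<tau> # map Atom as)) = length as + formula_size \<tau>"
proof -
  have "sum_list (map (formula_size \<circ> Atom) as) = length as"
    by (induction as) auto
  then show "formula_size (big_conj (map Atom as @ [\<tau>])) = length as + formula_size \<tau>"
    "formula_size (big_conj (\<tau> # map Atom as)) = length as + formula_size \<tau>"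
    by (simp_all add: formula_size_big_conj)
qed

lemma length_delete_le: "length (take (l - 1) xs @ drop l xs) \<le> length xs"
  unfolding length_append length_take length_drop by linarith

text \<open>The width allows for the two threshold formulae of the premiss and for the coweakened
  conjunction of at most \<open>length as\<close> atoms with one threshold formula; the extra 1
  gives the strict inequality required above.\<close>

lemma deriv_bound_Upsilon:
  fixes as :: "'v atom list"
  assumes "p = length as div 2"
    and "\<And>k. formula_size (theta k (take p as)) \<le> T" "\<And>k. formula_size (theta k (drop p as)) \<le> T"
  shows "deriv_bound (3 * (length as + 2 * T + 1)) (length as + 2 * T + 1) (Upsilon k l as)"
proof -
  define M where "M = length as + 2 * T + 1"
  define q where "q = length as - p"
  have 1: "formula_size (Conj (subst (as ! (l - 1)) Ff (theta p (take p as))) (theta (k - p) (drop p as))) \<le> M"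
    using assms(2)[of p] assms(3)[of "k - p"] by (simp add: formula_size_subst M_def)
  have 2: "formula_size (big_conj (map Atom (take (l - 1) (take p as) @ drop l (take p as))
      @ [theta (k - p) (drop p as)])) < M"
    using assms(3)[of "k - p"] length_delete_le[of l "take p as"]
      length_take[of p as]
    unfolding formula_size_big_conj_Atoms M_def by linarith
  have 3: "formula_size (Conj (theta (k - q) (take p as)) (subst (as ! (l - 1)) Ff (theta q (drop p as)))) \<le> M"
    using assms(2)[of "k - q"] assms(3)[of q] by (simp add: formula_size_subst M_def)
  have 4: "formula_size (big_conj (theta (k - q) (take p as) #
      map Atom (take (l - p - 1) (drop p as) @ drop (l - p) (drop p as)))) < M"
    using assms(2)[of "k - q"] length_delete_le[of "l - p" "drop p as"]
      length_drop[of p as]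
    unfolding formula_size_big_conj_Atoms M_def by linarith
  have "deriv_bound (3 * M) M [Ff :: 'v formula]"
    by (simp add: deriv_bound_def M_def)
  then show ?thesis
    using deriv_bound_coweaken_Conj_Ff[OF 1 2] deriv_bound_coweaken_Conj_Ff[OF 3 4]
    unfolding Upsilon_def Let_def M_def[symmetric] assms(1)[symmetric] q_def[symmetric]
    by (simp del: drop_drop)
qed

lemma deriv_bound_Delta:
  fixes as :: "'v atom list"
  assumes "p = length as div 2"
    and "\<And>k. formula_size (theta k (take p as)) \<le> T" "\<And>k. formula_size (theta k (drop p as)) \<le> T"
  shows "deriv_bound (3 * T) T (Delta k l as)"
proof -
  have "deriv_bound (3 * T) T (weaken b (theta k (take p as)))"
    "deriv_bound (3 * T) T (weaken b (theta k (drop p as)))" for b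
    using assms(2,3)[of k] by (auto intro: deriv_bound_mono[OF deriv_bound_weaken])
  moreover have "T \<ge> 1"
    using assms(2)[of 0] by simp
  then have "deriv_bound (3 * T) T [Ff :: 'v formula]"
    by (simp add: deriv_bound_def)
  ultimately show ?thesis
    unfolding Delta_def Let_def assms(1)[symmetric] by simp
qed

section \<open>The size of \<open>Gamma\<close>\<close>

lemma Gamma_short: "length as \<le> 1 \<Longrightarrow> Gamma k l as \<in> {[Tt], [Ff]}"
  by (subst Gamma.simps) (simp add: Let_def)

text \<open>Lines and width get one common bound \<open>Y\<close>. With \<open>m = 2 ^ Suc d\<close>
  bounding the number of atoms, the recursion costs a factor of at most \<open>16 * m\<close>, which
  is \<open>d + 5\<close> in the exponent, while the exponent grows by
  \<open>2 * d + 5\<close>.\<close>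

lemma deriv_bound_Gamma:
  "length as \<le> 2 ^ d \<Longrightarrow>
    deriv_bound (2 ^ (d * d + 4 * d + 3)) (2 ^ (d * d + 4 * d + 3)) (Gamma k l as)"
proof (induction d arbitrary: k l as)
  case 0
  then show ?case using Gamma_short[of as k l] by (auto simp: deriv_bound_def)
next
  case (Suc d)
  define Y :: nat where "Y = 2 ^ (d * d + 4 * d + 3)"
  define m :: nat where "m = 2 ^ Suc d"
  define p where "p = length as div 2"
  define q where "q = length as - p"
  define Z :: nat where "Z = 2 ^ (Suc d * Suc d + 4 * Suc d + 3)"
  have "16 * (m * Y) = 2 ^ (4 + (Suc d + (d * d + 4 * d + 3)))"
    unfolding m_def Y_def by (simp only: power_add) simp
  also have "\<dots> \<le> Z"
    unfolding Z_def by (rule power_increasing) auto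
  finally have step: "16 * (m * Y) \<le> Z" .
  have len: "length (take p as) \<le> 2 ^ d" "length (drop p as) \<le> 2 ^ d" "length as \<le> m"
    "p \<le> length as" "q \<le> length as"
    using Suc.prems by (auto simp: p_def q_def m_def)
  have "(2::nat) ^ (d * (d + 1)) \<le> Y"
    unfolding Y_def by (rule power_increasing) auto
  then have theta: "formula_size (theta k (take p as)) \<le> Y" "formula_size (theta k (drop p as)) \<le> Y" for k
    using formula_size_theta[OF len(1), of k] formula_size_theta[OF len(2), of k] by linarith+
  have IH: "deriv_bound Y Y (Gamma i l (take p as))" "deriv_bound Y Y (Gamma i l (drop p as))" for i l
    using Suc.IH len unfolding Y_def by auto
  have pos: "1 \<le> Y" "1 \<le> m" "1 \<le> Z" by (auto simp: Y_def m_def Z_def)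
  have prods: "Y \<le> m * Y" "m \<le> m * Y"
    using pos by simp_all
  have sum: "deriv_bound Z Z (big_disj_deriv (map \<Phi> xs @ [Upsilon k l as, Delta (Suc k) l as]))"
    if "\<And>x. x \<in> set xs \<Longrightarrow> deriv_bound Y (2 * Y) (\<Phi> x)" "length xs \<le> length as"
    for xs :: "(nat \<times> nat) list" and \<Phi>
  proof (rule deriv_bound_mono[OF deriv_bound_big_disj_deriv_append[OF that(1)
          deriv_bound_Upsilon[OF p_def theta] deriv_bound_Delta[OF p_def theta]]])
    define V W where "V = length xs * Y" and "W = m * Y"
    have "length xs * Y \<le> m * Y"
      using that(2) len(3) by (intro mult_le_mono1) linarith
    then have "V \<le> W" "Y \<le> W" "length as \<le> W" "1 \<le> W" "16 * W \<le> Z"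
      using prods len(3) pos step unfolding V_def W_def by linarith+
    \<comment> \<open>Every summand is at most a multiple of \<open>W\<close>; the line count adds
      up to \<open>1 + 3 + 6 + 3 + 3 = 16\<close> of them, which fixes the constant in
      \<open>step\<close>.\<close>
    then have "V + (3 * (length as + 2 * Y + 1) + 3 * Y) \<le> Z"
      "2 * V + (length as + 2 * Y + 1 + Y) \<le> Z"
      by (simp_all add: algebra_simps)
    then show "length xs * Y + (3 * (length as + 2 * Y + 1) + 3 * Y) \<le> Z"
      "length xs * (2 * Y) + (length as + 2 * Y + 1 + Y) \<le> Z"
      by (simp_all add: V_def mult.left_commute)
  qed
  consider "length as < k" | "length as \<le> 1" "k \<le> length as"
    | "length as \<ge> 2" "k \<le> length as" "l \<le> p" | "length as \<ge> 2" "k \<le> length as" "p < l"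
    by linarith
  then have "deriv_bound Z Z (Gamma k l as)"
  proof cases
    case 1
    then show ?thesis using pos by (simp add: Gamma_greater deriv_bound_def)
  next
    case 2
    then show ?thesis using Gamma_short[of as k l] pos by (auto simp: deriv_bound_def)
  next
    case 3
    have "deriv_bound (Y + 1 - 1) (Y + Y) (conj_deriv (Gamma i l (take p as)) [theta j (drop p as)])" for i j
      by (intro deriv_bound_conj_deriv IH deriv_bound_single theta)
    then show ?thesis
      unfolding Gamma_left[OF 3(1,2) p_def 3(3)] q_def[symmetric]
      using length_splits(1)[of k p "Suc q"] len by (intro sum) (auto simp: mult_2)
  next
    case 4
    have "deriv_bound (1 + Y - 1) (Y + Y) (conj_deriv [theta i (take p as)] (Gamma j (l - p) (drop p as)))" for i j
      by (intro deriv_bound_conj_deriv IH deriv_bound_single theta)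
    then show ?thesis
      unfolding Gamma_right[OF 4(1,2) p_def 4(3)] q_def[symmetric]
      using length_splits(2)[of k "Suc p" q] len by (intro sum) (auto simp: mult_2)
  qed
  then show ?case unfolding Z_def .
qed

text \<open>The bounds in powers of 2 are converted with \<open>d\<close> about
  \<open>log 2 n\<close>. The case of one atom is excluded because the right-hand side would then be
  1.\<close>

lemma deriv_size_Gamma:
  assumes "length as = n" "n \<ge> 2" "formula_size \<beta> = 1" "formula_size \<gamma> = 1"
  shows "real (deriv_size ([subst a \<beta> (theta k as)] @ Gamma k l as @ [subst b \<gamma> (theta k' as)]))
    \<le> real n powr (32 * log 2 (real n))"
proof -
  define x where "x = log 2 (real n)"
  define d where "d = nat \<lceil>x\<rceil>"
  have x: "1 \<le> x" "2 powr x = real n"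
    using assms by (auto simp: x_def le_log_iff)
  have d: "x \<le> real d" "real d \<le> x + 1"
    using x unfolding d_def by linarith+
  have "real n \<le> 2 powr real d"
    using x d by (metis powr_mono one_le_numeral)
  then have "real n \<le> real (2 ^ d)"
    by (simp add: powr_realpow)
  then have len: "length as \<le> 2 ^ d"
    using assms(1) of_nat_le_iff by blast
  define e where "e = d * d + 4 * d + 3"
  have "(2::nat) ^ (d * (d + 1)) \<le> 2 ^ e"
    unfolding e_def by (rule power_increasing) auto
  also have "(2::nat) ^ e \<le> 2 ^ e * 2 ^ e" by simp
  finally have theta: "formula_size (theta i as) \<le> 2 ^ e * 2 ^ e" for i
    using formula_size_theta[OF len, of i] by linarith
  have "deriv_size (Gamma k l as) \<le> 2 ^ e * 2 ^ e"
    using deriv_size_le[OF deriv_bound_Gamma[OF len]] unfolding e_def .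
  moreover have "deriv_size ([subst a \<beta> (theta k as)] @ Gamma k l as @ [subst b \<gamma> (theta k' as)])
    = formula_size (theta k as) + deriv_size (Gamma k l as) + formula_size (theta k' as)"
    using assms by (simp add: deriv_size_def formula_size_subst)
  \<comment> \<open>Three summands of at most \<open>2 ^ e * 2 ^ e\<close> each; rounding up to four
    keeps a power of 2.\<close>
  ultimately have "deriv_size ([subst a \<beta> (theta k as)] @ Gamma k l as @ [subst b \<gamma> (theta k' as)])
      \<le> 4 * (2 ^ e * 2 ^ e)"
    using theta[of k] theta[of k'] by linarith
  also have "\<dots> = 2 ^ (2 * e + 2)"
    by (simp add: power_add mult_2)
  finally have "real (deriv_size ([subst a \<beta> (theta k as)] @ Gamma k l as @ [subst b \<gamma> (theta k' as)]))
      \<le> real (2 ^ (2 * e + 2))"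
    by (simp only: of_nat_le_iff)
  also have "\<dots> = 2 powr real (2 * e + 2)"
    by (subst powr_realpow) simp_all
  also have "\<dots> \<le> 2 powr (x * (32 * x))"
  proof (rule powr_mono)
    have "real d * real d \<le> (x + 1) * (x + 1)"
      using d by (intro mult_mono) auto
    then have "real (2 * e + 2) \<le> 2 * ((x + 1) * (x + 1) + 4 * (x + 1) + 3) + 2"
      using d by (simp add: e_def)
    also have "\<dots> = 2 * (x * x) + 12 * x + 18"
      by (simp add: algebra_simps)
    \<comment> \<open>Since \<open>x \<ge> 1\<close>, every term is at most its coefficient times
      \<open>x * x\<close>, and \<open>2 + 12 + 18 = 32\<close>.\<close>
    also have "\<dots> \<le> x * (32 * x)"
    proof -
      have "x \<le> x * x" using x by simp
      then show ?thesis using x by linarith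
    qed
    finally show "real (2 * e + 2) \<le> x * (32 * x)" .
  qed simp
  also have "\<dots> = real n powr (32 * log 2 (real n))"
    unfolding x(2)[symmetric] powr_powr[symmetric] by (simp add: x_def powr_powr)
  finally show ?thesis .
qed

theorem theorem5p9:
  shows "\<exists>g :: nat \<Rightarrow> real. g \<in> O(\<lambda>n. log 2 (real n)) \<and>
    (\<forall>(as :: 'v atom list) (n :: nat) (k :: nat) (l :: nat).
       length as = n \<and> n > 0 \<and> distinct_atoms as \<and> 1 \<le> l \<and> l \<le> n \<longrightarrow>
       (let \<alpha> = subst (as ! (l - 1)) Ff (theta k as);
            \<beta> = subst (as ! (l - 1)) Tt (theta (k + 1) as);
            \<Gamma> = Gamma k l as
        in derivation {aw_down, aw_up, eq_rule} \<Gamma> (hd \<Gamma>) (last \<Gamma>) \<and>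
           eq_rule \<alpha> (hd \<Gamma>) \<and> eq_rule (last \<Gamma>) \<beta> \<and>
           derivation {aw_down, aw_up, eq_rule} ([\<alpha>] @ \<Gamma> @ [\<beta>]) \<alpha> \<beta> \<and>
           (n \<ge> 2 \<longrightarrow> real (deriv_size ([\<alpha>] @ \<Gamma> @ [\<beta>])) \<le> real n powr g n)))"
proof (intro exI[of _ "\<lambda>n. 32 * log 2 (real n)"] conjI allI impI)
  show "(\<lambda>n. 32 * log 2 (real n)) \<in> O(\<lambda>n. log 2 (real n))" by simp
next
  fix as :: "'v atom list" and n k l :: nat
  assume asm: "length as = n \<and> n > 0 \<and> distinct_atoms as \<and> 1 \<le> l \<and> l \<le> n"
  define \<alpha> where "\<alpha> = subst (as ! (l - 1)) Ff (theta k as)"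
  define \<beta> where "\<beta> = subst (as ! (l - 1)) Tt (theta (k + 1) as)"
  have "distinct as"
    using asm by (auto simp: distinct_atoms_def distinct_conv_nth)
  then have G: "derivation aw_rules (Gamma k l as) (hd (Gamma k l as)) (last (Gamma k l as))"
    "eq_rule \<alpha> (hd (Gamma k l as))" "eq_rule (last (Gamma k l as)) \<beta>"
    using Gamma_correct[of as l k] asm by (auto simp: \<alpha>_def \<beta>_def)
  \<comment> \<open>The ends differ from \<open>\<alpha>\<close> and \<open>\<beta>\<close> only by
    \<open>=\<close>, so each is attached by one further step.\<close>
  then have "derivation aw_rules (\<alpha> # Gamma k l as @ [\<beta>]) \<alpha> \<beta>"
    by (auto intro: derivation_Cons derivation_snoc inf_step_eq)
  moreover have "n \<ge> 2 \<longrightarrow> real (deriv_size ([\<alpha>] @ Gamma k l as @ [\<beta>])) \<le> real n powr (32 * log 2 (real n))"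
    unfolding \<alpha>_def \<beta>_def using asm by (intro impI deriv_size_Gamma) auto
  ultimately show "let \<alpha> = subst (as ! (l - 1)) Ff (theta k as);
            \<beta> = subst (as ! (l - 1)) Tt (theta (k + 1) as);
            \<Gamma> = Gamma k l as
        in derivation {aw_down, aw_up, eq_rule} \<Gamma> (hd \<Gamma>) (last \<Gamma>) \<and>
           eq_rule \<alpha> (hd \<Gamma>) \<and> eq_rule (last \<Gamma>) \<beta> \<and>
           derivation {aw_down, aw_up, eq_rule} ([\<alpha>] @ \<Gamma> @ [\<beta>]) \<alpha> \<beta> \<and>
           (n \<ge> 2 \<longrightarrow> real (deriv_size ([\<alpha>] @ \<Gamma> @ [\<beta>])) \<le> real n powr (32 * log 2 (real n)))"
    using G by (simp add: \<alpha>_def \<beta>_def Let_def)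
qed

end
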